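(* Let $(A,\mu,1_A,\alpha)$ be a Hom-algebra over a field $k$ and let $\lambda,\nu\in k^{\ast}=k\setminus\{0\}$. Assume that $\alpha$ is involutive, i.e. $\alpha\circ\alpha=\mathrm{id}_A$. Then the linear map $$B: A\otimes A\to A\otimes A,\qquad a\otimes b\mapsto \lambda\, ab\otimes 1_A+\nu\, 1_A\otimes ab-\lambda\,\alpha(a)\otimes\alpha(b)$$ is invertible, with inverse given by $$B^{-1}: A\otimes A\to A\otimes A,\qquad a\otimes b\mapsto \frac{1}{\nu}\, ab\otimes 1_A+\frac{1}{\lambda}\, 1_A\otimes ab-\frac{1}{\lambda}\,\alpha(a)\otimes\alpha(b).$$
   Context: Throughout, $k$ is a fixed field; vector spaces, linear maps and tensor products are over $k$. A Hom-algebra is a quadruple $(A,\mu,1_A,\alpha)$ where $A$ is a $k$-linear space, $\mu:A\otimes A\to A$ is a $k$-linear map (written $\mu(a\otimes a')=aa'$), $1_A\in A$, and $\alpha:A\to A$ is a linear endomorphism, such that for all $a,a',a''\in A$: $\alpha(aa')=\alpha(a)\alpha(a')$, $\alpha(1_A)=1_A$, $\alpha(a)(a'a'')=(aa')\alpha(a'')$, and $a1_A=1_Aa=\alpha(a)$. *)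

theory Defs
  imports Complex_Main "HOL-Library.Poly_Mapping" "HOL-Library.FuncSet"
begin

text \<open>
  A vector space over a field is a type \<^typ>\<open>'a\<close> with a scalar multiplication
  \<open>s :: 'k::field \<Rightarrow> 'a \<Rightarrow> 'a\<close> satisfying the locale \<^locale>\<open>vector_space\<close>.
  The tensor product of two such spaces is the free vector space on pairs modulo the subspace
  spanned by the bilinearity relations.  It depends on the scalar multiplications, which are
  terms, so it is a set of cosets with explicit operations and not a type.
\<close>

definition free_scale :: "'k::field \<Rightarrow> ('i \<Rightarrow>\<^sub>0 'k) \<Rightarrow> ('i \<Rightarrow>\<^sub>0 'k)" where
  "free_scale c f = Poly_Mapping.map (\<lambda>x. c * x) f"

abbreviation free_gen :: "'a \<Rightarrow> 'b \<Rightarrow> ('a \<times> 'b \<Rightarrow>\<^sub>0 'k::field)" where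
  "free_gen a b \<equiv> Poly_Mapping.single (a, b) 1"

definition bilinearity_relations ::
    "('k::field \<Rightarrow> 'a::ab_group_add \<Rightarrow> 'a) \<Rightarrow> ('k \<Rightarrow> 'b::ab_group_add \<Rightarrow> 'b)
     \<Rightarrow> ('a \<times> 'b \<Rightarrow>\<^sub>0 'k) set" where
  "bilinearity_relations s1 s2 =
     {free_gen (a + a') b - (free_gen a b + free_gen a' b) | a a' b. True} \<union>
     {free_gen a (b + b') - (free_gen a b + free_gen a b') | a b b'. True} \<union>
     {free_gen (s1 c a) b - free_scale c (free_gen a b) | c a b. True} \<union>
     {free_gen a (s2 c b) - free_scale c (free_gen a b) | c a b. True}"

definition tensor_equiv ::
    "('k::field \<Rightarrow> 'a::ab_group_add \<Rightarrow> 'a) \<Rightarrow> ('k \<Rightarrow> 'b::ab_group_add \<Rightarrow> 'b)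
     \<Rightarrow> (('a \<times> 'b \<Rightarrow>\<^sub>0 'k) \<times> ('a \<times> 'b \<Rightarrow>\<^sub>0 'k)) set" where
  "tensor_equiv s1 s2 = {(f, g). f - g \<in> module.span free_scale (bilinearity_relations s1 s2)}"

type_synonym ('k, 'a, 'b) tensor = "('a \<times> 'b \<Rightarrow>\<^sub>0 'k) set"

definition tensor_space ::
    "('k::field \<Rightarrow> 'a::ab_group_add \<Rightarrow> 'a) \<Rightarrow> ('k \<Rightarrow> 'b::ab_group_add \<Rightarrow> 'b)
     \<Rightarrow> ('k, 'a, 'b) tensor set" where
  "tensor_space s1 s2 = UNIV // tensor_equiv s1 s2"

definition tensor_pure ::
    "('k::field \<Rightarrow> 'a::ab_group_add \<Rightarrow> 'a) \<Rightarrow> ('k \<Rightarrow> 'b::ab_group_add \<Rightarrow> 'b)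
     \<Rightarrow> 'a \<Rightarrow> 'b \<Rightarrow> ('k, 'a, 'b) tensor" where
  "tensor_pure s1 s2 a b = tensor_equiv s1 s2 `` {free_gen a b}"

definition tensor_add ::
    "('k::field \<Rightarrow> 'a::ab_group_add \<Rightarrow> 'a) \<Rightarrow> ('k \<Rightarrow> 'b::ab_group_add \<Rightarrow> 'b)
     \<Rightarrow> ('k, 'a, 'b) tensor \<Rightarrow> ('k, 'a, 'b) tensor \<Rightarrow> ('k, 'a, 'b) tensor" where
  "tensor_add s1 s2 X Y = (\<Union>f\<in>X. \<Union>g\<in>Y. tensor_equiv s1 s2 `` {f + g})"

definition tensor_diff ::
    "('k::field \<Rightarrow> 'a::ab_group_add \<Rightarrow> 'a) \<Rightarrow> ('k \<Rightarrow> 'b::ab_group_add \<Rightarrow> 'b)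
     \<Rightarrow> ('k, 'a, 'b) tensor \<Rightarrow> ('k, 'a, 'b) tensor \<Rightarrow> ('k, 'a, 'b) tensor" where
  "tensor_diff s1 s2 X Y = (\<Union>f\<in>X. \<Union>g\<in>Y. tensor_equiv s1 s2 `` {f - g})"

definition tensor_scale ::
    "('k::field \<Rightarrow> 'a::ab_group_add \<Rightarrow> 'a) \<Rightarrow> ('k \<Rightarrow> 'b::ab_group_add \<Rightarrow> 'b)
     \<Rightarrow> 'k \<Rightarrow> ('k, 'a, 'b) tensor \<Rightarrow> ('k, 'a, 'b) tensor" where
  "tensor_scale s1 s2 c X = (\<Union>f\<in>X. tensor_equiv s1 s2 `` {free_scale c f})"

abbreviation tensor_square :: "('k::field \<Rightarrow> 'a::ab_group_add \<Rightarrow> 'a) \<Rightarrow> ('k, 'a, 'a) tensor set" where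
  "tensor_square s \<equiv> tensor_space s s"

abbreviation pure2 ("(_ \<otimes>\<^bsub>_\<^esub> _)" [76, 0, 76] 75) where
  "a \<otimes>\<^bsub>s\<^esub> b \<equiv> tensor_pure s s a b"

abbreviation scale2 ("(_ \<odot>\<^bsub>_\<^esub> _)" [71, 0, 70] 70) where
  "c \<odot>\<^bsub>s\<^esub> X \<equiv> tensor_scale s s c X"

abbreviation add2 ("(_ \<oplus>\<^bsub>_\<^esub> _)" [65, 0, 66] 65) where
  "X \<oplus>\<^bsub>s\<^esub> Y \<equiv> tensor_add s s X Y"

abbreviation diff2 ("(_ \<ominus>\<^bsub>_\<^esub> _)" [65, 0, 66] 65) where
  "X \<ominus>\<^bsub>s\<^esub> Y \<equiv> tensor_diff s s X Y"

text \<open>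
  The type \<^typ>\<open>('k, 'a, 'a) tensor\<close> also contains sets that are not cosets; linearity
  constrains a function only on the tensor square.
\<close>

definition linear_from_square ::
    "('k::field \<Rightarrow> 'a::ab_group_add \<Rightarrow> 'a) \<Rightarrow> (('k, 'a, 'a) tensor \<Rightarrow> 'a) \<Rightarrow> bool" where
  "linear_from_square s f \<longleftrightarrow>
     (\<forall>X\<in>tensor_square s. \<forall>Y\<in>tensor_square s. f (X \<oplus>\<^bsub>s\<^esub> Y) = f X + f Y) \<and>
     (\<forall>c. \<forall>X\<in>tensor_square s. f (c \<odot>\<^bsub>s\<^esub> X) = s c (f X))"

definition linear_endo_square ::
    "('k::field \<Rightarrow> 'a::ab_group_add \<Rightarrow> 'a)
     \<Rightarrow> (('k, 'a, 'a) tensor \<Rightarrow> ('k, 'a, 'a) tensor) \<Rightarrow> bool" where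
  "linear_endo_square s F \<longleftrightarrow>
     F \<in> tensor_square s \<rightarrow> tensor_square s \<and>
     (\<forall>X\<in>tensor_square s. \<forall>Y\<in>tensor_square s. F (X \<oplus>\<^bsub>s\<^esub> Y) = F X \<oplus>\<^bsub>s\<^esub> F Y) \<and>
     (\<forall>c. \<forall>X\<in>tensor_square s. F (c \<odot>\<^bsub>s\<^esub> X) = c \<odot>\<^bsub>s\<^esub> F X)"

locale hom_algebra = vector_space scale
  for scale :: "'k::field \<Rightarrow> 'a::ab_group_add \<Rightarrow> 'a" +
  fixes mu :: "('k, 'a, 'a) tensor \<Rightarrow> 'a"
    and one :: 'a
    and alpha :: "'a \<Rightarrow> 'a"
  assumes mu_linear: "linear_from_square scale mu"
    and alpha_linear: "Vector_Spaces.linear scale scale alpha"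
    and alpha_mult: "alpha (mu (a \<otimes>\<^bsub>scale\<^esub> b))
                     = mu (alpha a \<otimes>\<^bsub>scale\<^esub> alpha b)"
    and alpha_one: "alpha one = one"
    and hom_assoc: "mu (alpha a \<otimes>\<^bsub>scale\<^esub> mu (b \<otimes>\<^bsub>scale\<^esub> c))
                    = mu (mu (a \<otimes>\<^bsub>scale\<^esub> b) \<otimes>\<^bsub>scale\<^esub> alpha c)"
    and hom_unit_right: "mu (a \<otimes>\<^bsub>scale\<^esub> one) = alpha a"
    and hom_unit_left: "mu (one \<otimes>\<^bsub>scale\<^esub> a) = alpha a"

lemma lookup_free_scale [simp]: "Poly_Mapping.lookup (free_scale c f) i = c * Poly_Mapping.lookup f i"
  by (simp add: free_scale_def Poly_Mapping.map.rep_eq when_def)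

interpretation free: vector_space "free_scale :: 'k::field \<Rightarrow> ('i \<Rightarrow>\<^sub>0 'k) \<Rightarrow> ('i \<Rightarrow>\<^sub>0 'k)"
  by unfold_locales (auto intro!: poly_mapping_eqI simp: lookup_add algebra_simps)

lemma equiv_tensor_equiv: "equiv UNIV (tensor_equiv s1 s2)"
proof (rule equivI)
  show "refl (tensor_equiv s1 s2)"
    by (auto simp: refl_on_def tensor_equiv_def free.span_zero)
  show "sym (tensor_equiv s1 s2)"
    by (auto simp: sym_def tensor_equiv_def dest: free.span_neg)
  show "trans (tensor_equiv s1 s2)"
    unfolding trans_def tensor_equiv_def
    using free.span_add by fastforce
qed auto

lemma tensor_class_eq_iff:
  "tensor_equiv s1 s2 `` {f} = tensor_equiv s1 s2 `` {g}
   \<longleftrightarrow> f - g \<in> module.span free_scale (bilinearity_relations s1 s2)"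
  using eq_equiv_class_iff[OF equiv_tensor_equiv, of f g s1 s2] by (simp add: tensor_equiv_def)

lemma tensor_add_class:
  "tensor_add s1 s2 (tensor_equiv s1 s2 `` {f}) (tensor_equiv s1 s2 `` {g})
   = tensor_equiv s1 s2 `` {f + g}"
  unfolding tensor_add_def
proof (rule UN_equiv_class2[OF equiv_tensor_equiv equiv_tensor_equiv])
  show "congruent2 (tensor_equiv s1 s2) (tensor_equiv s1 s2) (\<lambda>f g. tensor_equiv s1 s2 `` {f + g})"
    unfolding congruent2_def tensor_class_eq_iff
    by (auto simp: tensor_equiv_def add_diff_add intro: free.span_add)
qed auto

lemma tensor_diff_class:
  "tensor_diff s1 s2 (tensor_equiv s1 s2 `` {f}) (tensor_equiv s1 s2 `` {g})
   = tensor_equiv s1 s2 `` {f - g}"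
  unfolding tensor_diff_def
proof (rule UN_equiv_class2[OF equiv_tensor_equiv equiv_tensor_equiv])
  have *: "f - g - (f' - g') = (f - f') - (g - g')" for f g f' g' :: "'a \<times> 'b \<Rightarrow>\<^sub>0 'c"
    by simp
  show "congruent2 (tensor_equiv s1 s2) (tensor_equiv s1 s2) (\<lambda>f g. tensor_equiv s1 s2 `` {f - g})"
    unfolding congruent2_def tensor_class_eq_iff
    by (auto simp only: tensor_equiv_def * mem_Collect_eq case_prod_conv intro!: free.span_diff)
qed auto

lemma tensor_scale_class:
  "tensor_scale s1 s2 c (tensor_equiv s1 s2 `` {f}) = tensor_equiv s1 s2 `` {free_scale c f}"
  unfolding tensor_scale_def
proof (rule UN_equiv_class[OF equiv_tensor_equiv])
  show "congruent (tensor_equiv s1 s2) (\<lambda>f. tensor_equiv s1 s2 `` {free_scale c f})"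
    unfolding congruent_def tensor_class_eq_iff
    by (auto simp: tensor_equiv_def simp flip: free.scale_right_diff_distrib intro: free.span_scale)
qed auto

end

theory Submission
  imports Defs
begin

text \<open>
  Both maps of the theorem belong to one three-parameter family of linear endomorphisms of
  \<open>A \<otimes> A\<close>,
  \<open>T(x, y, z) : a \<otimes> b \<mapsto> x ab \<otimes> 1 + y 1 \<otimes> ab - z \<alpha>(a) \<otimes> \<alpha>(b)\<close>,
  namely \<open>B = T\<close> at \<open>(\<lambda>, \<nu>, \<lambda>)\<close> and its claimed inverse at
  \<open>(1/\<nu>, 1/\<lambda>, 1/\<lambda>)\<close>.  Since \<open>\<alpha>\<close> is multiplicative, fixes \<open>1\<close> and is an involution, and
  since multiplication by \<open>1\<close> on either side is \<open>\<alpha>\<close>, the tensors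
  \<open>\<alpha>(ab) \<otimes> 1\<close>, \<open>1 \<otimes> \<alpha>(ab)\<close> and \<open>a \<otimes> b\<close> are all that appears when two members of the
  family are composed on \<open>a \<otimes> b\<close> (lemma \<open>twisted_map_compose\<close>).  The composite is
  the identity as soon as the first two coefficients vanish and the third is \<open>1\<close>, and
  for the two parameter triples above, in either order, this is a computation in \<open>k\<close>.

  It remains to work with linear maps on a tensor product given as a quotient.  A map on
  pairs that is bilinear modulo the relations induces a linear endomorphism
  (\<open>tensor_square_lift\<close>), and a linear endomorphism is determined by its values on pure
  tensors (\<open>linear_endo_square_eqI\<close>); the latter gives the uniqueness claims and reduces
  the identities between composites to pure tensors.
\<close>

section \<open>Linear maps on the tensor square\<close>

abbreviation tensor_class ::
    "('k::field \<Rightarrow> 'a::ab_group_add \<Rightarrow> 'a) \<Rightarrow> ('a \<times> 'a \<Rightarrow>\<^sub>0 'k) \<Rightarrow> ('k, 'a, 'a) tensor" where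
  "tensor_class s f \<equiv> tensor_equiv s s `` {f}"

lemma tensor_class_in_square [simp]: "tensor_class s f \<in> tensor_square s"
  by (simp add: tensor_space_def quotientI)

lemma tensor_squareE:
  assumes "X \<in> tensor_square s"
  obtains f where "X = tensor_class s f"
  using assms by (auto simp: tensor_space_def elim: quotientE)

lemma tensor_pure_in_square [simp]: "a \<otimes>\<^bsub>s\<^esub> b \<in> tensor_square s"
  by (simp add: tensor_pure_def)

lemma tensor_scale_in_square [simp]: "X \<in> tensor_square s \<Longrightarrow> c \<odot>\<^bsub>s\<^esub> X \<in> tensor_square s"
  by (auto elim!: tensor_squareE simp: tensor_scale_class)

lemma tensor_add_in_square [simp]:
  "X \<in> tensor_square s \<Longrightarrow> Y \<in> tensor_square s \<Longrightarrow> X \<oplus>\<^bsub>s\<^esub> Y \<in> tensor_square s"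
  by (auto elim!: tensor_squareE simp: tensor_add_class)

lemma tensor_pure_bilinear:
  shows tensor_pure_add_left: "(a + a') \<otimes>\<^bsub>s\<^esub> b = (a \<otimes>\<^bsub>s\<^esub> b) \<oplus>\<^bsub>s\<^esub> (a' \<otimes>\<^bsub>s\<^esub> b)"
    and tensor_pure_add_right: "a \<otimes>\<^bsub>s\<^esub> (b + b') = (a \<otimes>\<^bsub>s\<^esub> b) \<oplus>\<^bsub>s\<^esub> (a \<otimes>\<^bsub>s\<^esub> b')"
    and tensor_pure_scale_left: "s c a \<otimes>\<^bsub>s\<^esub> b = c \<odot>\<^bsub>s\<^esub> (a \<otimes>\<^bsub>s\<^esub> b)"
    and tensor_pure_scale_right: "a \<otimes>\<^bsub>s\<^esub> s c b = c \<odot>\<^bsub>s\<^esub> (a \<otimes>\<^bsub>s\<^esub> b)"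
  unfolding tensor_pure_def tensor_add_class tensor_scale_class tensor_class_eq_iff
  by (simp_all only: bilinearity_relations_def) (rule free.span_base, blast)+

lemma linear_endo_square_diff:
  assumes F: "linear_endo_square s F" and X: "X \<in> tensor_square s" and Y: "Y \<in> tensor_square s"
  shows "F (X \<ominus>\<^bsub>s\<^esub> Y) = F X \<ominus>\<^bsub>s\<^esub> F Y"
proof -
  have diff: "U \<ominus>\<^bsub>s\<^esub> V = U \<oplus>\<^bsub>s\<^esub> ((-1) \<odot>\<^bsub>s\<^esub> V)"
    if "U \<in> tensor_square s" "V \<in> tensor_square s" for U V
    using that by (auto elim!: tensor_squareE simp: tensor_diff_class tensor_add_class tensor_scale_class)
  have "F X \<in> tensor_square s" "F Y \<in> tensor_square s"
    using F X Y by (auto simp: linear_endo_square_def)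
  then show ?thesis
    using F X Y by (simp add: diff linear_endo_square_def)
qed

text \<open>
  Every formal combination of pairs is a sum of terms \<open>c \<cdot> (a, b)\<close>, so the pure tensors span
  the tensor square.
\<close>

lemma linear_endo_square_eqI:
  assumes F: "linear_endo_square s F" and G: "linear_endo_square s G"
    and pure: "\<And>a b. F (a \<otimes>\<^bsub>s\<^esub> b) = G (a \<otimes>\<^bsub>s\<^esub> b)"
    and X: "X \<in> tensor_square s"
  shows "F X = G X"
proof -
  have "F (tensor_class s f) = G (tensor_class s f)" for f
  proof (induction f rule: update_induct)
    case const
    have "tensor_class s 0 = 0 \<odot>\<^bsub>s\<^esub> (0 \<otimes>\<^bsub>s\<^esub> 0)"
      by (simp add: tensor_pure_def tensor_scale_class)
    then show ?case
      using F G pure by (simp add: linear_endo_square_def)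
  next
    case (update f p c)
    obtain a b where p: "p = (a, b)" by (cases p)
    have "Poly_Mapping.update p c f = f + free_scale c (free_gen a b)"
      using update.hyps
      by (intro poly_mapping_eqI)
         (auto simp: p lookup_update lookup_add lookup_single when_def in_keys_iff)
    then have "tensor_class s (Poly_Mapping.update p c f) = tensor_class s f \<oplus>\<^bsub>s\<^esub> (c \<odot>\<^bsub>s\<^esub> (a \<otimes>\<^bsub>s\<^esub> b))"
      by (simp add: tensor_pure_def tensor_scale_class tensor_add_class)
    then show ?case
      using F G pure update by (simp add: linear_endo_square_def)
  qed
  then show ?thesis
    using X by (auto elim: tensor_squareE)
qed

lemma linear_endo_square_comp:
  "linear_endo_square s F \<Longrightarrow> linear_endo_square s G \<Longrightarrow> linear_endo_square s (F \<circ> G)"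
  by (auto simp: linear_endo_square_def Pi_iff)

lemma linear_endo_square_id: "linear_endo_square s id"
  by (auto simp: linear_endo_square_def)

definition free_extend ::
    "('a \<Rightarrow> 'b \<Rightarrow> ('i \<Rightarrow>\<^sub>0 'k::field)) \<Rightarrow> ('a \<times> 'b \<Rightarrow>\<^sub>0 'k) \<Rightarrow> ('i \<Rightarrow>\<^sub>0 'k)" where
  "free_extend \<phi> f =
     (\<Sum>p\<in>Poly_Mapping.keys f. free_scale (Poly_Mapping.lookup f p) (\<phi> (fst p) (snd p)))"

lemma free_extend_superset:
  assumes "finite K" "Poly_Mapping.keys f \<subseteq> K"
  shows "free_extend \<phi> f = (\<Sum>p\<in>K. free_scale (Poly_Mapping.lookup f p) (\<phi> (fst p) (snd p)))"
  unfolding free_extend_def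
  by (rule sum.mono_neutral_left) (use assms in \<open>auto simp: in_keys_iff\<close>)

lemma free_extend_linear:
  shows free_extend_add: "free_extend \<phi> (f + g) = free_extend \<phi> f + free_extend \<phi> g"
    and free_extend_scale: "free_extend \<phi> (free_scale c f) = free_scale c (free_extend \<phi> f)"
proof -
  let ?K = "Poly_Mapping.keys f \<union> Poly_Mapping.keys g"
  have "Poly_Mapping.keys (f + g) \<subseteq> ?K"
    by (rule Poly_Mapping.keys_add)
  then show "free_extend \<phi> (f + g) = free_extend \<phi> f + free_extend \<phi> g"
    by (simp add: free_extend_superset[of ?K] lookup_add free.scale_left_distrib sum.distrib)
  have "Poly_Mapping.keys (free_scale c f) \<subseteq> Poly_Mapping.keys f"
    by (auto simp: in_keys_iff)
  then show "free_extend \<phi> (free_scale c f) = free_scale c (free_extend \<phi> f)"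
    by (simp add: free_extend_superset[of "Poly_Mapping.keys f"] free.scale_sum_right)
qed

lemma free_extend_diff: "free_extend \<phi> (f - g) = free_extend \<phi> f - free_extend \<phi> g"
  using free_extend_add[of \<phi> "f - g" g] by simp

lemma free_extend_gen: "free_extend \<phi> (free_gen a b) = \<phi> a b"
  by (simp add: free_extend_def)

text \<open>
  This is the existence half of the universal property, with the target map given by
  representatives \<open>\<phi> a b\<close>: bilinearity modulo the relations says that the linear extension
  of \<open>\<phi>\<close> to the free space sends each relation into the span of the relations, hence descends
  to the quotient.
\<close>

lemma tensor_square_lift:
  fixes s :: "'k::field \<Rightarrow> 'a::ab_group_add \<Rightarrow> 'a"
    and \<phi> :: "'a \<Rightarrow> 'a \<Rightarrow> ('a \<times> 'a \<Rightarrow>\<^sub>0 'k)"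
  assumes add_left: "\<And>a a' b. tensor_class s (\<phi> (a + a') b) = tensor_class s (\<phi> a b + \<phi> a' b)"
    and add_right: "\<And>a b b'. tensor_class s (\<phi> a (b + b')) = tensor_class s (\<phi> a b + \<phi> a b')"
    and scale_left: "\<And>c a b. tensor_class s (\<phi> (s c a) b) = tensor_class s (free_scale c (\<phi> a b))"
    and scale_right: "\<And>c a b. tensor_class s (\<phi> a (s c b)) = tensor_class s (free_scale c (\<phi> a b))"
  obtains F where "linear_endo_square s F" "\<And>a b. F (a \<otimes>\<^bsub>s\<^esub> b) = tensor_class s (\<phi> a b)"
proof -
  let ?R = "bilinearity_relations s s"
  have rel: "free_extend \<phi> r \<in> free.span ?R" if "r \<in> ?R" for r
    using that add_left add_right scale_left scale_right
    unfolding bilinearity_relations_def tensor_class_eq_iff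
    by (auto simp: free_extend_add free_extend_scale free_extend_diff free_extend_gen)
  have span: "free_extend \<phi> f \<in> free.span ?R" if "f \<in> free.span ?R" for f
    using that
  proof (induction rule: free.span_induct_alt)
    case base
    show ?case by (simp add: free_extend_def free.span_zero)
  next
    case (step c r f)
    then show ?case
      by (simp add: free_extend_add free_extend_scale rel free.span_add free.span_scale)
  qed
  define F where "F X = (\<Union>f\<in>X. tensor_class s (free_extend \<phi> f))" for X
  have F_class: "F (tensor_class s f) = tensor_class s (free_extend \<phi> f)" for f
    unfolding F_def
  proof (rule UN_equiv_class[OF equiv_tensor_equiv])
    show "congruent (tensor_equiv s s) (\<lambda>f. tensor_class s (free_extend \<phi> f))"
      unfolding congruent_def tensor_class_eq_iff
      by (auto simp: tensor_equiv_def span simp flip: free_extend_diff)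
  qed auto
  show thesis
  proof
    show "linear_endo_square s F"
      unfolding linear_endo_square_def
      by (auto elim!: tensor_squareE
          simp: F_class tensor_add_class tensor_scale_class free_extend_add free_extend_scale)
    show "F (a \<otimes>\<^bsub>s\<^esub> b) = tensor_class s (\<phi> a b)" for a b
      by (simp add: tensor_pure_def F_class free_extend_gen)
  qed
qed

section \<open>The three-parameter family\<close>

context hom_algebra
begin

text \<open>
  The value at \<open>a \<otimes> b\<close> of \<open>T(x, y, z)\<close>.  Three independent coefficients are needed because the
  third one equals the first for \<open>B\<close> but the second for its inverse.
\<close>

definition twisted ::
    "'k \<Rightarrow> 'k \<Rightarrow> 'k \<Rightarrow> 'a \<Rightarrow> 'a \<Rightarrow> ('k, 'a, 'a) tensor" where
  "twisted x y z a b =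
     (x \<odot>\<^bsub>scale\<^esub> (mu (a \<otimes>\<^bsub>scale\<^esub> b) \<otimes>\<^bsub>scale\<^esub> one))
     \<oplus>\<^bsub>scale\<^esub> (y \<odot>\<^bsub>scale\<^esub> (one \<otimes>\<^bsub>scale\<^esub> mu (a \<otimes>\<^bsub>scale\<^esub> b)))
     \<ominus>\<^bsub>scale\<^esub> (z \<odot>\<^bsub>scale\<^esub> (alpha a \<otimes>\<^bsub>scale\<^esub> alpha b))"

definition twisted_map ::
    "'k \<Rightarrow> 'k \<Rightarrow> 'k \<Rightarrow> (('k, 'a, 'a) tensor \<Rightarrow> ('k, 'a, 'a) tensor) \<Rightarrow> bool" where
  "twisted_map x y z F \<longleftrightarrow> linear_endo_square scale F
     \<and> (\<forall>a b. F (a \<otimes>\<^bsub>scale\<^esub> b) = twisted x y z a b)"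

lemma mu_bilinear:
  shows "mu ((a + a') \<otimes>\<^bsub>scale\<^esub> b) = mu (a \<otimes>\<^bsub>scale\<^esub> b) + mu (a' \<otimes>\<^bsub>scale\<^esub> b)"
    and "mu (a \<otimes>\<^bsub>scale\<^esub> (b + b')) = mu (a \<otimes>\<^bsub>scale\<^esub> b) + mu (a \<otimes>\<^bsub>scale\<^esub> b')"
    and "mu (scale c a \<otimes>\<^bsub>scale\<^esub> b) = scale c (mu (a \<otimes>\<^bsub>scale\<^esub> b))"
    and "mu (a \<otimes>\<^bsub>scale\<^esub> scale c b) = scale c (mu (a \<otimes>\<^bsub>scale\<^esub> b))"
  using mu_linear by (simp_all add: linear_from_square_def tensor_pure_bilinear)

lemma twisted_map_exists: "\<exists>F. twisted_map x y z F"
proof -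
  let ?m = "\<lambda>a b. mu (a \<otimes>\<^bsub>scale\<^esub> b)"
  define \<phi> :: "'a \<Rightarrow> 'a \<Rightarrow> ('a \<times> 'a \<Rightarrow>\<^sub>0 'k)" where
    "\<phi> a b = free_scale x (free_gen (?m a b) one) + free_scale y (free_gen one (?m a b))
      - free_scale z (free_gen (alpha a) (alpha b))" for a b
  have \<phi>: "tensor_class scale (\<phi> a b) = twisted x y z a b" for a b
    by (simp add: \<phi>_def twisted_def tensor_pure_def
        flip: tensor_add_class tensor_diff_class tensor_scale_class)
  have alpha: "alpha (a + b) = alpha a + alpha b" "alpha (scale c a) = scale c (alpha a)" for a b c
    using module_hom.add module_hom.scale alpha_linear[folded module_hom_iff_linear] by metis+
  (* In this order, the products are expanded while their arguments are still pure tensors;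
     then both sides become classes of the same formal combination of pairs. *)
  have bilinear:
      "tensor_class scale (\<phi> (a + a') b) = tensor_class scale (\<phi> a b + \<phi> a' b)"
      "tensor_class scale (\<phi> a (b + b')) = tensor_class scale (\<phi> a b + \<phi> a b')"
      "tensor_class scale (\<phi> (scale c a) b) = tensor_class scale (free_scale c (\<phi> a b))"
      "tensor_class scale (\<phi> a (scale c b)) = tensor_class scale (free_scale c (\<phi> a b))"
    for a a' b b' c
    unfolding \<phi> tensor_add_class[symmetric] tensor_scale_class[symmetric]
    unfolding twisted_def mu_bilinear alpha
    unfolding tensor_pure_bilinear
    unfolding tensor_pure_def tensor_add_class tensor_diff_class tensor_scale_class
    by (rule arg_cong[where f = "tensor_class scale"], rule poly_mapping_eqI,
        simp add: lookup_add lookup_minus algebra_simps)+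
  obtain F where "linear_endo_square scale F"
    and "\<And>a b. F (a \<otimes>\<^bsub>scale\<^esub> b) = tensor_class scale (\<phi> a b)"
    by (rule tensor_square_lift[OF bilinear]) blast
  then show ?thesis
    by (auto simp: twisted_map_def \<phi>)
qed

text \<open>
  By the unit laws, \<open>T(x', y', z')\<close> sends both \<open>ab \<otimes> 1\<close> and \<open>1 \<otimes> ab\<close> to combinations of
  \<open>\<alpha>(ab) \<otimes> 1\<close> and \<open>1 \<otimes> \<alpha>(ab)\<close>; by multiplicativity it sends \<open>\<alpha>(a) \<otimes> \<alpha>(b)\<close> to a
  combination of the same two tensors and \<open>\<alpha>\<^sup>2(a) \<otimes> \<alpha>\<^sup>2(b) = a \<otimes> b\<close>.  Collecting
  coefficients gives the formula.
\<close>

lemma twisted_map_compose: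
  assumes invol: "alpha \<circ> alpha = id"
    and F: "twisted_map x' y' z' F" and G: "twisted_map x y z G"
  shows "F (G (a \<otimes>\<^bsub>scale\<^esub> b)) =
     ((x * (x' - z') + y * x' - z * x') \<odot>\<^bsub>scale\<^esub> (alpha (mu (a \<otimes>\<^bsub>scale\<^esub> b)) \<otimes>\<^bsub>scale\<^esub> one))
     \<oplus>\<^bsub>scale\<^esub> ((x * y' + y * (y' - z') - z * y')
        \<odot>\<^bsub>scale\<^esub> (one \<otimes>\<^bsub>scale\<^esub> alpha (mu (a \<otimes>\<^bsub>scale\<^esub> b))))
     \<oplus>\<^bsub>scale\<^esub> ((z * z') \<odot>\<^bsub>scale\<^esub> (a \<otimes>\<^bsub>scale\<^esub> b))"
proof -
  let ?p = "mu (a \<otimes>\<^bsub>scale\<^esub> b)"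
  have alpha2: "alpha (alpha c) = c" for c
    using invol by (simp add: fun_eq_iff)
  have lin: "linear_endo_square scale F" and pure: "F (c \<otimes>\<^bsub>scale\<^esub> d) = twisted x' y' z' c d" for c d
    using F by (auto simp: twisted_map_def)
  have "F (G (a \<otimes>\<^bsub>scale\<^esub> b)) =
      (x \<odot>\<^bsub>scale\<^esub> F (?p \<otimes>\<^bsub>scale\<^esub> one)) \<oplus>\<^bsub>scale\<^esub> (y \<odot>\<^bsub>scale\<^esub> F (one \<otimes>\<^bsub>scale\<^esub> ?p))
      \<ominus>\<^bsub>scale\<^esub> (z \<odot>\<^bsub>scale\<^esub> F (alpha a \<otimes>\<^bsub>scale\<^esub> alpha b))"
    using G lin
    by (simp add: twisted_map_def twisted_def linear_endo_square_diff[OF lin])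
       (simp add: linear_endo_square_def)
  also have "\<dots> =
     ((x * (x' - z') + y * x' - z * x') \<odot>\<^bsub>scale\<^esub> (alpha ?p \<otimes>\<^bsub>scale\<^esub> one))
     \<oplus>\<^bsub>scale\<^esub> ((x * y' + y * (y' - z') - z * y') \<odot>\<^bsub>scale\<^esub> (one \<otimes>\<^bsub>scale\<^esub> alpha ?p))
     \<oplus>\<^bsub>scale\<^esub> ((z * z') \<odot>\<^bsub>scale\<^esub> (a \<otimes>\<^bsub>scale\<^esub> b))"
    unfolding pure twisted_def hom_unit_right hom_unit_left alpha_mult[symmetric] alpha_one alpha2
    unfolding tensor_pure_def tensor_add_class tensor_diff_class tensor_scale_class
    by (rule arg_cong[where f = "tensor_class scale"], rule poly_mapping_eqI)
       (simp add: lookup_add lookup_minus algebra_simps)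
  finally show ?thesis .
qed

lemma twisted_map_compose_id:
  assumes invol: "alpha \<circ> alpha = id"
    and F: "twisted_map x' y' z' F" and G: "twisted_map x y z G"
    and coeffs: "x * (x' - z') + y * x' - z * x' = 0" "x * y' + y * (y' - z') - z * y' = 0"
      "z * z' = 1"
    and X: "X \<in> tensor_square scale"
  shows "F (G X) = X"
proof -
  have "(0 \<odot>\<^bsub>scale\<^esub> U) \<oplus>\<^bsub>scale\<^esub> (0 \<odot>\<^bsub>scale\<^esub> V) \<oplus>\<^bsub>scale\<^esub> (1 \<odot>\<^bsub>scale\<^esub> W) = W"
    if "U \<in> tensor_square scale" "V \<in> tensor_square scale" "W \<in> tensor_square scale" for U V W
    using that by (auto elim!: tensor_squareE simp: tensor_scale_class tensor_add_class)
  then have "(F \<circ> G) (a \<otimes>\<^bsub>scale\<^esub> b) = id (a \<otimes>\<^bsub>scale\<^esub> b)" for a b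
    using twisted_map_compose[OF invol F G] by (simp add: coeffs)
  moreover have "linear_endo_square scale (F \<circ> G)"
    using F G by (intro linear_endo_square_comp) (simp_all add: twisted_map_def)
  ultimately have "(F \<circ> G) X = id X"
    using linear_endo_square_eqI linear_endo_square_id X by blast
  then show ?thesis by simp
qed

end

section \<open>Invertibility\<close>

theorem corollary2p2:
  fixes scale :: "'k::field \<Rightarrow> 'a::ab_group_add \<Rightarrow> 'a"
    and mu :: "('k, 'a, 'a) tensor \<Rightarrow> 'a"
    and one :: 'a
    and alpha :: "'a \<Rightarrow> 'a"
    and lam nu :: 'k
  assumes "hom_algebra scale mu one alpha"
    and "lam \<noteq> 0" and "nu \<noteq> 0"
    and "alpha \<circ> alpha = id"
  shows "\<exists>B B'.
      linear_endo_square scale B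
    \<and> (\<forall>a b. B (a \<otimes>\<^bsub>scale\<^esub> b) =
          (lam \<odot>\<^bsub>scale\<^esub> (mu (a \<otimes>\<^bsub>scale\<^esub> b) \<otimes>\<^bsub>scale\<^esub> one))
          \<oplus>\<^bsub>scale\<^esub> (nu \<odot>\<^bsub>scale\<^esub> (one \<otimes>\<^bsub>scale\<^esub> mu (a \<otimes>\<^bsub>scale\<^esub> b)))
          \<ominus>\<^bsub>scale\<^esub> (lam \<odot>\<^bsub>scale\<^esub> (alpha a \<otimes>\<^bsub>scale\<^esub> alpha b)))
    \<and> (\<forall>F. linear_endo_square scale F
          \<and> (\<forall>a b. F (a \<otimes>\<^bsub>scale\<^esub> b) = B (a \<otimes>\<^bsub>scale\<^esub> b))
          \<longrightarrow> (\<forall>X\<in>tensor_square scale. F X = B X))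
    \<and> linear_endo_square scale B'
    \<and> (\<forall>a b. B' (a \<otimes>\<^bsub>scale\<^esub> b) =
          ((1 / nu) \<odot>\<^bsub>scale\<^esub> (mu (a \<otimes>\<^bsub>scale\<^esub> b) \<otimes>\<^bsub>scale\<^esub> one))
          \<oplus>\<^bsub>scale\<^esub> ((1 / lam) \<odot>\<^bsub>scale\<^esub> (one \<otimes>\<^bsub>scale\<^esub> mu (a \<otimes>\<^bsub>scale\<^esub> b)))
          \<ominus>\<^bsub>scale\<^esub> ((1 / lam) \<odot>\<^bsub>scale\<^esub> (alpha a \<otimes>\<^bsub>scale\<^esub> alpha b)))
    \<and> (\<forall>F. linear_endo_square scale F
          \<and> (\<forall>a b. F (a \<otimes>\<^bsub>scale\<^esub> b) = B' (a \<otimes>\<^bsub>scale\<^esub> b))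
          \<longrightarrow> (\<forall>X\<in>tensor_square scale. F X = B' X))
    \<and> bij_betw B (tensor_square scale) (tensor_square scale)
    \<and> (\<forall>X\<in>tensor_square scale. B' (B X) = X \<and> B (B' X) = X)"
proof -
  interpret hom_algebra scale mu one alpha by fact
  obtain B where B: "twisted_map lam nu lam B"
    using twisted_map_exists by blast
  obtain B' where B': "twisted_map (1 / nu) (1 / lam) (1 / lam) B'"
    using twisted_map_exists by blast
  have left: "B' (B X) = X" if "X \<in> tensor_square scale" for X
    by (rule twisted_map_compose_id[OF assms(4) B' B _ _ _ that])
       (use assms(2,3) in \<open>simp_all add: field_simps\<close>)
  have right: "B (B' X) = X" if "X \<in> tensor_square scale" for X
    by (rule twisted_map_compose_id[OF assms(4) B B' _ _ _ that])
       (use assms(2,3) in \<open>simp_all add: field_simps\<close>)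
  have lin: "linear_endo_square scale B" "linear_endo_square scale B'"
    using B B' by (simp_all add: twisted_map_def)
  then have bij: "bij_betw B (tensor_square scale) (tensor_square scale)"
    by (intro bij_betwI[where g = B']) (simp_all add: left right linear_endo_square_def)
  have unique: "\<forall>F. linear_endo_square scale F \<and> (\<forall>a b. F (a \<otimes>\<^bsub>scale\<^esub> b) = H (a \<otimes>\<^bsub>scale\<^esub> b))
      \<longrightarrow> (\<forall>X\<in>tensor_square scale. F X = H X)"
    if "linear_endo_square scale H" for H
    using that linear_endo_square_eqI by blast
  note pure = B[unfolded twisted_map_def twisted_def, THEN conjunct2]
    B'[unfolded twisted_map_def twisted_def, THEN conjunct2]
  have inverse: "\<forall>X\<in>tensor_square scale. B' (B X) = X \<and> B (B' X) = X"
    using left right by blast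
  show ?thesis
    by (intro exI[of _ B] exI[of _ B'] conjI)
       (rule lin pure unique[OF lin(1)] unique[OF lin(2)] bij inverse)+
qed

end
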